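(* Let $C\in\mathbb{R}^{n\times n}$ be symmetric. Given a penalty sequence $\{\rho^k\}$ such that $$(\rho^k)^2-L_H\rho^k-(\alpha+1)L_1^2>0,\qquad \rho^k>L_H,\qquad \alpha>0,$$ under the vector ADMM algorithm (described in the context) the augmented Lagrangian monotonically decreases: $$\mathcal{L}(y^{k+1},x^{k+1};\mu^{k+1})-\mathcal{L}(y^k,x^k;\mu^k)\le -c_1^k\|x^{k+1}-x^k\|_F^2,$$ with $c_1^k=\frac{\rho^k-L_H}{2}-\frac{(\alpha+1)L_1^2}{2\rho^k}>0$. If, in addition, the value $x^TCx$ is lower bounded over $x\in\{-1,1\}^n$ and $\rho^k>L_1$, then the augmented Lagrangian $\mathcal{L}(y^k,x^k;\mu^k)$ is lower bounded and convergent. Therefore $\{y^k,x^k,\mu^k\}$ converges to $\{y^*,x^*,\mu^*\}$, a KKT solution of the problem $$\min_{x,y\in\mathbb{R}^n} x^TCx\quad\text{subject to}\quad y\in\{-1,1\}^n,\ x=y,$$ and $x^*=y^*$.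
   Context: Constants: $L_1$ is such that $x\mapsto x^TCx$ is $L_1$-smooth, i.e. $\|2Cx_1-2Cx_2\|\le L_1\|x_1-x_2\|$ for any $x_1,x_2$. $L_H\in\mathbb{R}_+$ is the smallest number such that $-L_HI\preceq 2C$ ($2C$ is the Hessian of $x^TCx$). Augmented Lagrangian: for $x,y\in\mathbb{R}^n$, dual variable $\mu\in\mathbb{R}^n$ and penalty weight $\rho>0$, $$\mathcal{L}(y,x;\mu)=x^TCx+\langle\mu,x-y\rangle+\frac{\rho}{2}\|x-y\|_F^2,$$ where $\rho=\rho^k$ when it is evaluated at the iterates $(y^k,x^k;\mu^k)$. For vectors $\|\cdot\|_F$ is the Euclidean norm. Vector ADMM algorithm: inputs are $C$, an initial penalty $\rho^0>0$ and a factor $\alpha$ (the algorithm's input list says $\alpha>1$); $x^0,y^0,\mu^0$ are initialized as random vectors. At each iteration $k$: (1) $y^{k+1}$ is a solution of $\min_y\|x^k-y+\mu^k/\rho^k\|_F^2$ subject to $y\in\{-1,1\}^n$, i.e. $y_i^{k+1}=\mathrm{sign}(x^k+\mu^k/\rho^k)_i$; (2) $x^{k+1}$ is the minimizer over $x$ of $x^TCx+\frac{\rho^k}{2}\|x-y^{k+1}+\mu^k/\rho^k\|_F^2$; (3) $\mu^{k+1}=\mu^k+\rho^k(x^{k+1}-y^{k+1})$ and $\rho^{k+1}=\alpha\rho^k$. In practice the loop is stopped once $\|x^k-y^k\|\le\epsilon$ for a tolerance $\epsilon>0$; the convergence statement concerns the sequence of iterates without stopping. KKT solution: no separate definition is given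 by the authors; in their proof the property is asserted in the form that $x^*=y^*\in\{-1,1\}^n$ is feasible and $\nabla_x\mathcal{L}(y^*,x^*;\mu^* )=\nabla_y\mathcal{L}(y^*,x^*;\mu^* )=0$.
   Formalization: The decrease is claimed for k≥1 only (it can fail at k=0 for arbitrary initial vectors), and KKT stationarity in y includes multipliers for the constraints y_i^2=1, since the gradient in y of the augmented Lagrangian alone need not vanish at the limit. *)

theory Defs
  imports "HOL-Analysis.Analysis"
begin

definition quad_form :: "real ^ 'n ^ 'n \<Rightarrow> real ^ 'n \<Rightarrow> real" where
  "quad_form A x = x \<bullet> (A *v x)"

definition loewner_le :: "real ^ 'n ^ 'n \<Rightarrow> real ^ 'n ^ 'n \<Rightarrow> bool" where
  "loewner_le A B \<longleftrightarrow> transpose (B - A) = B - A \<and> (\<forall>v. 0 \<le> quad_form (B - A) v)"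

definition sign_vectors :: "(real ^ 'n) set" where
  "sign_vectors = {y. \<forall>i. y $ i \<in> {-1, 1}}"

text \<open>For symmetric \<open>C\<close> the gradient of the quadratic form of \<open>C\<close> at \<open>x\<close> is \<open>2Cx\<close>,
  and its Hessian is \<open>2C\<close>.\<close>

definition quad_smooth_const :: "real ^ 'n ^ 'n \<Rightarrow> real \<Rightarrow> bool" where
  "quad_smooth_const C L \<longleftrightarrow>
     (\<forall>x1 x2. norm ((2 *\<^sub>R C) *v x1 - (2 *\<^sub>R C) *v x2) \<le> L * norm (x1 - x2))"

definition hessian_lower_const :: "real ^ 'n ^ 'n \<Rightarrow> real \<Rightarrow> bool" where
  "hessian_lower_const C L \<longleftrightarrow>
     0 \<le> L \<and> loewner_le (- (L *\<^sub>R mat 1)) (2 *\<^sub>R C) \<and>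
     (\<forall>L'\<ge>0. loewner_le (- (L' *\<^sub>R mat 1)) (2 *\<^sub>R C) \<longrightarrow> L \<le> L')"

definition aug_lagrangian ::
    "real ^ 'n ^ 'n \<Rightarrow> real \<Rightarrow> real ^ 'n \<Rightarrow> real ^ 'n \<Rightarrow> real ^ 'n \<Rightarrow> real" where
  "aug_lagrangian C \<rho> y x \<mu> = quad_form C x + \<mu> \<bullet> (x - y) + \<rho> / 2 * (norm (x - y))\<^sup>2"

text \<open>The initial vectors \<open>x 0\<close>, \<open>y 0\<close>, \<open>\<mu> 0\<close> are arbitrary. The \<open>y\<close>-update may be any
  minimizer over the sign vectors, that is, a componentwise sign with an arbitrary choice
  of \<open>1\<close> or \<open>-1\<close> at zero components.\<close>

definition vector_admm ::
    "real ^ 'n ^ 'n \<Rightarrow> real \<Rightarrow> (nat \<Rightarrow> real) \<Rightarrow>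
     (nat \<Rightarrow> real ^ 'n) \<Rightarrow> (nat \<Rightarrow> real ^ 'n) \<Rightarrow> (nat \<Rightarrow> real ^ 'n) \<Rightarrow> bool" where
  "vector_admm C \<alpha> \<rho> y x \<mu> \<longleftrightarrow> 0 < \<rho> 0 \<and>
     (\<forall>k.
        is_arg_min (\<lambda>v. (norm (x k - v + (1 / \<rho> k) *\<^sub>R \<mu> k))\<^sup>2)
          (\<lambda>v. v \<in> sign_vectors) (y (Suc k)) \<and>
        is_arg_min (\<lambda>u. quad_form C u + \<rho> k / 2 * (norm (u - y (Suc k) + (1 / \<rho> k) *\<^sub>R \<mu> k))\<^sup>2)
          (\<lambda>_. True) (x (Suc k)) \<and>
        \<mu> (Suc k) = \<mu> k + \<rho> k *\<^sub>R (x (Suc k) - y (Suc k)) \<and>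
        \<rho> (Suc k) = \<alpha> * \<rho> k)"

definition descent_const :: "real \<Rightarrow> real \<Rightarrow> real \<Rightarrow> real \<Rightarrow> real" where
  "descent_const L1 LH \<alpha> \<rho> = (\<rho> - LH) / 2 - (\<alpha> + 1) * L1\<^sup>2 / (2 * \<rho>)"

text \<open>KKT conditions of minimizing \<open>quad_form C x\<close> subject to \<open>x = y\<close> and \<open>y \<in> sign_vectors\<close>.
  The latter constraint is the system of equations \<open>(y $ i)\<^sup>2 = 1\<close>, with multipliers \<open>\<nu> $ i\<close>;
  \<open>\<mu>\<close> is the multiplier of \<open>x = y\<close>. The term with \<open>\<nu>\<close> cannot be omitted: stationarity in both
  blocks without it would force \<open>\<mu> = 0\<close> and \<open>C *v x = 0\<close>.
  At points with \<open>x = y\<close> the penalty term does not contribute to the gradients, so the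
  conditions do not depend on \<open>\<rho>\<close>.\<close>

definition kkt_solution ::
    "real ^ 'n ^ 'n \<Rightarrow> real ^ 'n \<Rightarrow> real ^ 'n \<Rightarrow> real ^ 'n \<Rightarrow> bool" where
  "kkt_solution C y x \<mu> \<longleftrightarrow>
     y \<in> sign_vectors \<and> x = y \<and>
     (\<exists>\<nu> :: real ^ 'n. \<forall>\<rho>>0.
        GDERIV (\<lambda>u. aug_lagrangian C \<rho> y u \<mu>) x :> 0 \<and>
        GDERIV (\<lambda>v. aug_lagrangian C \<rho> v x \<mu> + (\<Sum>i\<in>UNIV. \<nu> $ i * ((v $ i)\<^sup>2 - 1))) y :> 0)"

end

theory Submission
  imports Defs
begin

text \<open>
  After the first iteration the multiplier is determined by the primal variable: stationarity of
  the \<open>x\<close>-update, combined with the multiplier update, says \<open>\<mu> k = - 2 C (x k)\<close>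
  (\<open>multiplier_eq_neg_gradient\<close>). Smoothness therefore bounds a multiplier step by
  \<open>L1\<close> times the corresponding step of \<open>x\<close>.

  Descent balances the three updates. The \<open>y\<close>-update does not increase the augmented Lagrangian.
  The \<open>x\<close>-update minimizes a function that is strongly convex with modulus \<open>\<rho> - LH\<close>, so it gains
  \<open>(\<rho> - LH) / 2\<close> times the squared step (\<open>x_update_descent\<close>). Updating multiplier and penalty
  together costs exactly \<open>(\<alpha> + 1) / (2 \<rho>)\<close> times the squared multiplier step
  (\<open>multiplier_update_increase\<close>). The coefficient \<open>descent_const\<close> is the gain minus the bound
  on the cost.

  Since \<open>\<mu> k\<close> is the negative gradient at \<open>x k\<close>, its inner product with \<open>x k - y k\<close> is the
  first-order term of the Taylor expansion at \<open>x k\<close>, evaluated at \<open>y k\<close>. The penalty dominates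
  the second-order term, so the augmented Lagrangian is at least the objective at the sign vector
  \<open>y k\<close> (\<open>lagrangian_value_ge\<close>). Decreasing from the first iteration on and bounded below, its
  values converge.

  Convergence of the values makes the steps of \<open>x\<close> tend to zero. For \<open>\<alpha> \<ge> 1\<close> the descent
  coefficients are bounded away from zero. For \<open>\<alpha> < 1\<close> they are not, but then \<open>\<rho>\<close> tends to
  zero and the penalty condition forces \<open>L1 = 0\<close>, hence \<open>C = 0\<close>, a case in which \<open>x\<close> stops
  moving after two iterations. Small steps of \<open>x\<close> give small residuals \<open>x k - y k\<close>, hence small
  steps of \<open>y\<close>. But \<open>y\<close> moves in a discrete set, so it is eventually constant, \<open>x\<close> has the same
  limit, and \<open>\<mu>\<close> follows by continuity. At the limit the equations \<open>(y $ i)\<^sup>2 = 1\<close> admit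
  multipliers because no \<open>y $ i\<close> is zero (\<open>kkt_solution_at_sign_vector\<close>).
\<close>

section \<open>Quadratic forms of symmetric matrices\<close>

lemma inner_matrix_vector_symmetric:
  fixes C :: "real ^ 'n ^ 'n"
  assumes "transpose C = C"
  shows "u \<bullet> (C *v v) = (C *v u) \<bullet> v"
  by (metis assms dot_lmul_matrix transpose_matrix_vector)

lemma quad_form_add:
  fixes C :: "real ^ 'n ^ 'n"
  assumes "transpose C = C"
  shows "quad_form C (a + d) = quad_form C a + 2 * ((C *v a) \<bullet> d) + quad_form C d"
  unfolding quad_form_def
  by (simp add: matrix_vector_right_distrib inner_add_left inner_add_right
      inner_matrix_vector_symmetric[OF assms, of a d] inner_commute[of d "C *v a"])

lemma scaleR_matrix_vector:
  fixes C :: "real ^ 'n ^ 'm"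
  shows "(c *\<^sub>R C) *v v = c *\<^sub>R (C *v v)"
  by (simp add: scaleR_matrix_vector_assoc)

lemma quad_form_ge_hessian_lower:
  fixes C :: "real ^ 'n ^ 'n"
  assumes "hessian_lower_const C LH"
  shows "- (LH / 2) * (norm v)\<^sup>2 \<le> quad_form C v"
proof -
  have "0 \<le> quad_form (2 *\<^sub>R C - (- (LH *\<^sub>R mat 1))) v"
    using assms by (auto simp: hessian_lower_const_def loewner_le_def)
  also have "\<dots> = 2 * quad_form C v + LH * (norm v)\<^sup>2"
    by (simp add: quad_form_def matrix_vector_mult_add_rdistrib scaleR_matrix_vector
        inner_add_right power2_norm_eq_inner)
  finally show ?thesis by (simp add: field_simps)
qed

lemma quad_smooth_norm_le:
  fixes C :: "real ^ 'n ^ 'n"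
  assumes "quad_smooth_const C L"
  shows "2 * norm (C *v v) \<le> L * norm v"
  using assms[unfolded quad_smooth_const_def, rule_format, of v 0]
  by (simp add: scaleR_matrix_vector)

lemma quad_form_le_smooth:
  fixes C :: "real ^ 'n ^ 'n"
  assumes "quad_smooth_const C L"
  shows "quad_form C v \<le> L / 2 * (norm v)\<^sup>2"
proof -
  have "quad_form C v \<le> norm v * norm (C *v v)"
    unfolding quad_form_def by (rule norm_cauchy_schwarz)
  also have "\<dots> \<le> norm v * (L / 2 * norm v)"
    using quad_smooth_norm_le[OF assms, of v] by (intro mult_left_mono) auto
  finally show ?thesis by (simp add: power2_eq_square algebra_simps)
qed

lemma GDERIV_quad_form:
  fixes C :: "real ^ 'n ^ 'n"
  assumes "transpose C = C"
  shows "GDERIV (quad_form C) u :> 2 *\<^sub>R (C *v u)"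
proof -
  have "(quad_form C has_derivative (\<lambda>h. u \<bullet> (C *v h) + h \<bullet> (C *v u))) (at u)"
    unfolding quad_form_def
    by (intro has_derivative_inner has_derivative_ident
        bounded_linear_imp_has_derivative[OF matrix_vector_mul_bounded_linear])
  moreover have "u \<bullet> (C *v h) + h \<bullet> (C *v u) = h \<bullet> (2 *\<^sub>R (C *v u))" for h
    by (simp add: inner_matrix_vector_symmetric[OF assms, of u h] inner_commute)
  ultimately show ?thesis
    unfolding gderiv_def by simp
qed

section \<open>The augmented Lagrangian\<close>

text \<open>Both subproblems of the algorithm are stated with the square on the right; this identity
  turns them into minimizations of the augmented Lagrangian itself.\<close>

lemma aug_lagrangian_complete_square:
  fixes C :: "real ^ 'n ^ 'n"
  assumes "\<rho> \<noteq> 0"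
  shows "aug_lagrangian C \<rho> y x \<mu> =
    quad_form C x + \<rho> / 2 * (norm (x - y + (1 / \<rho>) *\<^sub>R \<mu>))\<^sup>2 - (norm \<mu>)\<^sup>2 / (2 * \<rho>)"
proof -
  define r where "r = x - y"
  have "(norm (r + (1 / \<rho>) *\<^sub>R \<mu>))\<^sup>2 = (norm r)\<^sup>2 + 2 / \<rho> * (\<mu> \<bullet> r) + (norm \<mu>)\<^sup>2 / \<rho>\<^sup>2"
    unfolding power2_norm_eq_inner
    by (simp add: inner_add_left inner_add_right inner_commute power2_eq_square)
  then show ?thesis
    using assms by (simp add: aug_lagrangian_def r_def[symmetric] field_simps power2_eq_square)
qed

lemma GDERIV_aug_lagrangian_primal:
  fixes C :: "real ^ 'n ^ 'n"
  assumes "transpose C = C"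
  shows "GDERIV (\<lambda>u. aug_lagrangian C \<rho> y u \<mu>) x :> 2 *\<^sub>R (C *v x) + \<mu> + \<rho> *\<^sub>R (x - y)"
proof -
  have "((\<lambda>u. quad_form C u + \<mu> \<bullet> (u - y) + \<rho> / 2 * ((u - y) \<bullet> (u - y))) has_derivative
      (\<lambda>h. h \<bullet> (2 *\<^sub>R (C *v x)) + \<mu> \<bullet> h + \<rho> / 2 * ((x - y) \<bullet> h + h \<bullet> (x - y)))) (at x)"
    by (auto intro!: derivative_eq_intros GDERIV_quad_form[OF assms, unfolded gderiv_def])
  moreover have "h \<bullet> (2 *\<^sub>R (C *v x)) + \<mu> \<bullet> h + \<rho> / 2 * ((x - y) \<bullet> h + h \<bullet> (x - y)) =
      h \<bullet> (2 *\<^sub>R (C *v x) + \<mu> + \<rho> *\<^sub>R (x - y))" for h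
    by (simp add: inner_add_right inner_commute[of "x - y" h] inner_commute[of \<mu> h])
  ultimately show ?thesis
    unfolding gderiv_def aug_lagrangian_def power2_norm_eq_inner by simp
qed

lemma GDERIV_aug_lagrangian_sign:
  fixes C :: "real ^ 'n ^ 'n" and \<nu> :: "real ^ 'n"
  shows "GDERIV (\<lambda>v. aug_lagrangian C \<rho> v x \<mu> + (\<Sum>i\<in>UNIV. \<nu> $ i * ((v $ i)\<^sup>2 - 1))) y :>
      (\<chi> i. 2 * \<nu> $ i * y $ i - \<mu> $ i - \<rho> * (x - y) $ i)"
proof -
  have component: "((\<lambda>v. v $ i) has_derivative (\<lambda>h. h $ i)) (at y)" for i
    by (rule bounded_linear_imp_has_derivative[OF bounded_linear_vec_nth])
  have "((\<lambda>v. \<nu> $ i * (v $ i * v $ i - 1)) has_derivative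
      (\<lambda>h. \<nu> $ i * (y $ i * h $ i + h $ i * y $ i))) (at y)" for i
    using has_derivative_mult_right[OF has_derivative_diff
        [OF has_derivative_mult[OF component component] has_derivative_const],
        of "\<nu> $ i" i i 1]
    by (simp only: diff_zero)
  moreover have "((\<lambda>v. quad_form C x + \<mu> \<bullet> (x - v) + \<rho> / 2 * ((x - v) \<bullet> (x - v))) has_derivative
      (\<lambda>h. \<mu> \<bullet> (- h) + \<rho> / 2 * ((x - y) \<bullet> (- h) + (- h) \<bullet> (x - y)))) (at y)"
    by (auto intro!: derivative_eq_intros)
  ultimately have "((\<lambda>v. quad_form C x + \<mu> \<bullet> (x - v) + \<rho> / 2 * ((x - v) \<bullet> (x - v))
        + (\<Sum>i\<in>UNIV. \<nu> $ i * (v $ i * v $ i - 1))) has_derivative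
      (\<lambda>h. \<mu> \<bullet> (- h) + \<rho> / 2 * ((x - y) \<bullet> (- h) + (- h) \<bullet> (x - y))
        + (\<Sum>i\<in>UNIV. \<nu> $ i * (y $ i * h $ i + h $ i * y $ i)))) (at y)"
    by (rule has_derivative_add[OF _ has_derivative_sum, rotated])
  moreover have "\<mu> \<bullet> (- h) + \<rho> / 2 * ((x - y) \<bullet> (- h) + (- h) \<bullet> (x - y))
        + (\<Sum>i\<in>UNIV. \<nu> $ i * (y $ i * h $ i + h $ i * y $ i))
      = h \<bullet> (\<chi> i. 2 * \<nu> $ i * y $ i - \<mu> $ i - \<rho> * (x - y) $ i)" for h
    unfolding inner_vec_def sum_distrib_left sum.distrib[symmetric]
    by (intro sum.cong) (auto simp: algebra_simps)
  ultimately show ?thesis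
    unfolding gderiv_def aug_lagrangian_def power2_norm_eq_inner power2_eq_square[of "_ $ _"]
    by simp
qed

text \<open>Stationarity in \<open>x\<close> prescribes \<open>\<mu>\<close>. Stationarity in \<open>y\<close> then reads
  \<open>2 \<nu>\<^sub>i y\<^sub>i = \<mu>\<^sub>i\<close>, which is solvable for any \<open>\<mu>\<close> since the constraint gradients do not vanish
  at a sign vector.\<close>

lemma kkt_solution_at_sign_vector:
  fixes C :: "real ^ 'n ^ 'n"
  assumes "transpose C = C" "y \<in> sign_vectors" "\<mu> = - (2 *\<^sub>R (C *v y))"
  shows "kkt_solution C y y \<mu>"
proof -
  \<comment> \<open>Multiplying by \<open>y $ i\<close> is the same as dividing by it, because \<open>y $ i\<close> is its own inverse.\<close>
  define \<nu> :: "real ^ 'n" where "\<nu> = (\<chi> i. \<mu> $ i * y $ i / 2)"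
  have "y $ i \<in> {-1, 1}" for i
    using assms(2) by (simp add: sign_vectors_def)
  then have "y $ i * y $ i = 1" for i
    by (metis empty_iff insert_iff mult_1 mult_minus1 minus_minus)
  then have "2 * \<nu> $ i * y $ i = \<mu> $ i" for i
    by (simp add: \<nu>_def mult.assoc)
  then have "(\<chi> i. 2 * \<nu> $ i * y $ i - \<mu> $ i - \<rho> * (y - y) $ i) = 0" for \<rho>
    by (simp add: vec_eq_iff)
  then have "GDERIV (\<lambda>v. aug_lagrangian C \<rho> v y \<mu> + (\<Sum>i\<in>UNIV. \<nu> $ i * ((v $ i)\<^sup>2 - 1))) y :> 0"
    for \<rho> using GDERIV_aug_lagrangian_sign[of C \<rho> y \<mu> \<nu> y] by simp
  moreover have "GDERIV (\<lambda>u. aug_lagrangian C \<rho> y u \<mu>) y :> 0" for \<rho>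
    using GDERIV_aug_lagrangian_primal[OF assms(1), of \<rho> y \<mu> y] assms(3) by simp
  ultimately show ?thesis
    using assms(2) unfolding kkt_solution_def by (intro conjI exI[of _ \<nu>] allI impI refl)
qed

section \<open>Sequences of sign vectors\<close>

lemma sign_vectors_eq_if_close:
  assumes "a \<in> sign_vectors" "b \<in> sign_vectors" "norm (a - b) < 2"
  shows "a = b"
proof (rule ccontr)
  assume "a \<noteq> b"
  then obtain i where "a $ i \<noteq> b $ i"
    by (auto simp: vec_eq_iff)
  moreover have "a $ i \<in> {-1, 1}" "b $ i \<in> {-1, 1}"
    using assms(1,2) by (auto simp: sign_vectors_def)
  ultimately have "\<bar>(a - b) $ i\<bar> = 2"
    by auto
  then show False
    using component_le_norm_cart[of "a - b" i] assms(3) by simp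
qed

lemma sign_vectors_eventually_constant:
  assumes "\<And>k. k \<ge> N \<Longrightarrow> s k \<in> sign_vectors"
    and "(\<lambda>k. s (Suc k) - s k) \<longlonglongrightarrow> 0"
  obtains v where "v \<in> sign_vectors" "eventually (\<lambda>k. s k = v) sequentially"
proof -
  obtain K where K: "\<And>k. k \<ge> K \<Longrightarrow> norm (s (Suc k) - s k) < 2"
    using LIMSEQ_D[OF assms(2), of 2] by auto
  define M where "M = max K N"
  have "s k = s M" if "k \<ge> M" for k
    using that
  proof (induction k rule: dec_induct)
    case (step k)
    then have "s (Suc k) = s k"
      by (intro sign_vectors_eq_if_close assms(1) K) (auto simp: M_def)
    with step show ?case by simp
  qed simp
  then have "eventually (\<lambda>k. s k = s M) sequentially"
    unfolding eventually_sequentially by blast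
  moreover have "s M \<in> sign_vectors"
    by (rule assms(1)) (simp add: M_def)
  ultimately show thesis
    by (rule that[rotated])
qed

section \<open>Runs of the algorithm\<close>

locale vector_admm_run =
  fixes C :: "real ^ 'n ^ 'n"
    and \<alpha> L1 LH :: real
    and \<rho> :: "nat \<Rightarrow> real"
    and y x \<mu> :: "nat \<Rightarrow> real ^ 'n"
  assumes symmetric: "transpose C = C"
    and smooth: "quad_smooth_const C L1"
    and hessian: "hessian_lower_const C LH"
    and growth_pos: "0 < \<alpha>"
    and penalty_large: "\<And>k. (\<rho> k)\<^sup>2 - LH * \<rho> k - (\<alpha> + 1) * L1\<^sup>2 > 0"
    and penalty_gt: "\<And>k. \<rho> k > LH"
    and admm: "vector_admm C \<alpha> \<rho> y x \<mu>"
begin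

lemma LH_nonneg: "0 \<le> LH"
  using hessian by (simp add: hessian_lower_const_def)

lemma penalty_pos: "0 < \<rho> k"
  using penalty_gt[of k] LH_nonneg by simp

lemma multiplier_update: "\<mu> (Suc k) = \<mu> k + \<rho> k *\<^sub>R (x (Suc k) - y (Suc k))"
  and penalty_Suc: "\<rho> (Suc k) = \<alpha> * \<rho> k"
  using admm by (auto simp: vector_admm_def)

lemma penalty_power: "\<rho> k = \<alpha> ^ k * \<rho> 0"
  by (induction k) (auto simp: penalty_Suc)

text \<open>The initial \<open>y 0\<close> is arbitrary, hence the restriction on \<open>k\<close>.\<close>

lemma y_sign: "1 \<le> k \<Longrightarrow> y k \<in> sign_vectors"
  using admm by (cases k) (auto simp: vector_admm_def is_arg_min_def)

lemma y_update_le: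
  assumes "v \<in> sign_vectors"
  shows "aug_lagrangian C (\<rho> k) (y (Suc k)) (x k) (\<mu> k) \<le> aug_lagrangian C (\<rho> k) v (x k) (\<mu> k)"
proof -
  have "(norm (x k - y (Suc k) + (1 / \<rho> k) *\<^sub>R \<mu> k))\<^sup>2 \<le> (norm (x k - v + (1 / \<rho> k) *\<^sub>R \<mu> k))\<^sup>2"
    using admm assms unfolding vector_admm_def is_arg_min_linorder by blast
  from mult_left_mono[OF this, of "\<rho> k / 2"] show ?thesis
    using penalty_pos[of k] by (simp add: aug_lagrangian_complete_square)
qed

lemma x_update_le:
  "aug_lagrangian C (\<rho> k) (y (Suc k)) (x (Suc k)) (\<mu> k)
    \<le> aug_lagrangian C (\<rho> k) (y (Suc k)) u (\<mu> k)"
proof -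
  have "quad_form C (x (Suc k)) + \<rho> k / 2 * (norm (x (Suc k) - y (Suc k) + (1 / \<rho> k) *\<^sub>R \<mu> k))\<^sup>2
      \<le> quad_form C u + \<rho> k / 2 * (norm (u - y (Suc k) + (1 / \<rho> k) *\<^sub>R \<mu> k))\<^sup>2"
    using admm unfolding vector_admm_def is_arg_min_linorder by blast
  then show ?thesis
    using penalty_pos[of k] by (simp add: aug_lagrangian_complete_square)
qed

lemma x_update_stationary:
  "2 *\<^sub>R (C *v x (Suc k)) + \<mu> k + \<rho> k *\<^sub>R (x (Suc k) - y (Suc k)) = 0" (is "?g = 0")
proof -
  have "(\<lambda>h. h \<bullet> ?g) = (\<lambda>h. 0)"
  proof (rule has_derivative_local_min)
    show "((\<lambda>u. aug_lagrangian C (\<rho> k) (y (Suc k)) u (\<mu> k)) has_derivative (\<lambda>h. h \<bullet> ?g))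
        (at (x (Suc k)))"
      using GDERIV_aug_lagrangian_primal[OF symmetric] unfolding gderiv_def .
  qed (simp add: x_update_le)
  then have "?g \<bullet> ?g = 0" by meson
  then show ?thesis by simp
qed

text \<open>The multiplier update adds precisely the penalty part of the gradient at the new \<open>x\<close>, so
  the stationarity equation of the \<open>x\<close>-update becomes a formula for the new multiplier. The
  arbitrary initial data need not satisfy it.\<close>

lemma multiplier_eq_neg_gradient:
  assumes "1 \<le> k"
  shows "\<mu> k = - (2 *\<^sub>R (C *v x k))"
proof -
  obtain j where k: "k = Suc j"
    using assms by (cases k) auto
  have "2 *\<^sub>R (C *v x k) + \<mu> k = 0"
    using x_update_stationary[of j] unfolding k multiplier_update[of j] by (simp only: add.assoc)
  then show ?thesis by (simp add: eq_neg_iff_add_eq_0 add.commute)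
qed

lemma multiplier_step_le:
  assumes "1 \<le> k"
  shows "norm (\<mu> (Suc k) - \<mu> k) \<le> L1 * norm (x (Suc k) - x k)"
proof -
  have "\<mu> (Suc k) - \<mu> k = - (2 *\<^sub>R (C *v (x (Suc k) - x k)))"
    using assms by (simp add: multiplier_eq_neg_gradient matrix_vector_mult_diff_distrib
        scaleR_diff_right)
  then show ?thesis
    using quad_smooth_norm_le[OF smooth, of "x (Suc k) - x k"] by simp
qed

lemma residual_eq: "x (Suc k) - y (Suc k) = (1 / \<rho> k) *\<^sub>R (\<mu> (Suc k) - \<mu> k)"
  using penalty_pos[of k] by (simp add: multiplier_update)

text \<open>Expanding the quadratic function \<open>u \<mapsto> \<L>(y (k+1), u; \<mu> k)\<close> around its minimizer
  \<open>x (k+1)\<close> leaves no linear term, and the curvature of the quadratic term is at least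
  \<open>\<rho> k - LH\<close> in every direction.\<close>

lemma x_update_descent:
  "aug_lagrangian C (\<rho> k) (y (Suc k)) (x (Suc k)) (\<mu> k)
      + (\<rho> k - LH) / 2 * (norm (x (Suc k) - x k))\<^sup>2
    \<le> aug_lagrangian C (\<rho> k) (y (Suc k)) (x k) (\<mu> k)"
proof -
  define a d r where "a = x (Suc k)" and "d = x k - x (Suc k)" and "r = x (Suc k) - y (Suc k)"
  have xk: "x k = a + d" "x k - y (Suc k) = r + d" and a: "a - y (Suc k) = r"
    by (simp_all add: a_def d_def r_def)
  have "(2 *\<^sub>R (C *v a) + \<mu> k + \<rho> k *\<^sub>R r) \<bullet> d = 0"
    using x_update_stationary[of k] by (simp add: a_def r_def)
  then have first_order: "2 * ((C *v a) \<bullet> d) + \<mu> k \<bullet> d + \<rho> k * (r \<bullet> d) = 0"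
    by (simp add: inner_add_left)
  have "aug_lagrangian C (\<rho> k) (y (Suc k)) (x k) (\<mu> k)
      = quad_form C a + 2 * ((C *v a) \<bullet> d) + quad_form C d + \<mu> k \<bullet> (r + d)
        + \<rho> k / 2 * (norm (r + d))\<^sup>2"
    unfolding aug_lagrangian_def xk(2) unfolding xk(1) quad_form_add[OF symmetric] ..
  also have "\<dots> = quad_form C a + \<mu> k \<bullet> r + \<rho> k / 2 * (norm r)\<^sup>2
      + quad_form C d + \<rho> k / 2 * (norm d)\<^sup>2"
    using first_order
    by (simp add: power2_norm_eq_inner inner_add_left inner_add_right inner_commute[of d r]
        algebra_simps)
  also have "\<dots> = aug_lagrangian C (\<rho> k) (y (Suc k)) a (\<mu> k) + quad_form C d + \<rho> k / 2 * (norm d)\<^sup>2"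
    by (simp add: aug_lagrangian_def a)
  finally have "aug_lagrangian C (\<rho> k) (y (Suc k)) (x k) (\<mu> k) =
    aug_lagrangian C (\<rho> k) (y (Suc k)) a (\<mu> k) + quad_form C d + \<rho> k / 2 * (norm d)\<^sup>2" .
  moreover have "- (LH / 2) * (norm d)\<^sup>2 \<le> quad_form C d"
    by (rule quad_form_ge_hessian_lower[OF hessian])
  moreover have "norm (x (Suc k) - x k) = norm d"
    by (simp add: d_def norm_minus_commute)
  ultimately show ?thesis
    by (simp add: a_def algebra_simps diff_divide_distrib)
qed

text \<open>With \<open>r = x (k+1) - y (k+1)\<close>, the multiplier update adds \<open>\<rho> k\<close> times the squared norm of \<open>r\<close>
  and the penalty update adds \<open>(\<alpha> - 1) \<rho> k / 2\<close> times that square; the multiplier step is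
  \<open>\<rho> k\<close> times \<open>r\<close>.\<close>

lemma multiplier_update_increase:
  "aug_lagrangian C (\<rho> (Suc k)) (y (Suc k)) (x (Suc k)) (\<mu> (Suc k))
    = aug_lagrangian C (\<rho> k) (y (Suc k)) (x (Suc k)) (\<mu> k)
      + (\<alpha> + 1) / (2 * \<rho> k) * (norm (\<mu> (Suc k) - \<mu> k))\<^sup>2"
proof -
  define r where "r = x (Suc k) - y (Suc k)"
  have step: "\<mu> (Suc k) = \<mu> k + \<rho> k *\<^sub>R r"
    by (simp add: multiplier_update r_def)
  then have "(\<alpha> + 1) / (2 * \<rho> k) * (norm (\<mu> (Suc k) - \<mu> k))\<^sup>2 = (\<alpha> + 1) * \<rho> k / 2 * (norm r)\<^sup>2"
    using penalty_pos[of k] by (simp add: power_mult_distrib field_simps power2_eq_square)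
  moreover have "\<mu> (Suc k) \<bullet> r = \<mu> k \<bullet> r + \<rho> k * (norm r)\<^sup>2"
    by (simp add: step inner_add_left power2_norm_eq_inner)
  ultimately show ?thesis
    by (simp add: aug_lagrangian_def r_def[symmetric] penalty_Suc field_simps)
qed

abbreviation lagrangian_value :: "nat \<Rightarrow> real" where
  "lagrangian_value k \<equiv> aug_lagrangian C (\<rho> k) (y k) (x k) (\<mu> k)"

lemma descent:
  assumes "1 \<le> k"
  shows "lagrangian_value (Suc k) - lagrangian_value k
    \<le> - descent_const L1 LH \<alpha> (\<rho> k) * (norm (x (Suc k) - x k))\<^sup>2"
proof -
  have "(norm (\<mu> (Suc k) - \<mu> k))\<^sup>2 \<le> L1\<^sup>2 * (norm (x (Suc k) - x k))\<^sup>2"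
    using power_mono[OF multiplier_step_le[OF assms], of 2] by (simp add: power_mult_distrib)
  from mult_left_mono[OF this, of "(\<alpha> + 1) / (2 * \<rho> k)"]
  have "lagrangian_value (Suc k) \<le> aug_lagrangian C (\<rho> k) (y (Suc k)) (x (Suc k)) (\<mu> k)
      + (\<alpha> + 1) * L1\<^sup>2 / (2 * \<rho> k) * (norm (x (Suc k) - x k))\<^sup>2"
    using penalty_pos[of k] growth_pos by (simp add: multiplier_update_increase)
  then show ?thesis
    using x_update_descent[of k] y_update_le[OF y_sign[OF assms], of k]
    by (simp add: descent_const_def left_diff_distrib)
qed

lemma descent_const_pos: "descent_const L1 LH \<alpha> (\<rho> k) > 0"
proof -
  have "descent_const L1 LH \<alpha> (\<rho> k) = ((\<rho> k)\<^sup>2 - LH * \<rho> k - (\<alpha> + 1) * L1\<^sup>2) / (2 * \<rho> k)"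
    using penalty_pos[of k] by (simp add: descent_const_def field_simps power2_eq_square)
  then show ?thesis
    using penalty_large[of k] penalty_pos[of k] by simp
qed

text \<open>The expansion of the objective from \<open>x k\<close> to \<open>y k\<close> has \<open>\<mu> k \<bullet> (x k - y k)\<close> as its linear
  term, and its quadratic term is at most the penalty term.\<close>

lemma lagrangian_value_ge:
  assumes "1 \<le> k" "L1 \<le> \<rho> k"
  shows "quad_form C (y k) \<le> lagrangian_value k"
proof -
  define d where "d = y k - x k"
  have "quad_form C (y k) = quad_form C (x k + d)"
    by (simp add: d_def)
  also have "\<dots> = quad_form C (x k) + 2 * ((C *v x k) \<bullet> d) + quad_form C d"
    by (rule quad_form_add[OF symmetric])
  also have "\<dots> = quad_form C (x k) + \<mu> k \<bullet> (x k - y k) + quad_form C d"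
    using assms(1) by (simp add: multiplier_eq_neg_gradient d_def inner_diff_right)
  also have "quad_form C d \<le> L1 / 2 * (norm d)\<^sup>2"
    by (rule quad_form_le_smooth[OF smooth])
  also have "\<dots> \<le> \<rho> k / 2 * (norm (x k - y k))\<^sup>2"
    using assms(2) by (auto intro!: mult_right_mono simp: d_def norm_minus_commute)
  finally show ?thesis
    by (simp add: aug_lagrangian_def)
qed

lemma bounded_below_lagrangian_values:
  assumes "bdd_below (quad_form C ` sign_vectors)" "\<And>k. L1 \<le> \<rho> k"
  shows "bdd_below (range lagrangian_value)"
proof -
  obtain m where m: "\<And>v. v \<in> sign_vectors \<Longrightarrow> m \<le> quad_form C v"
    using assms(1) by (auto simp: bdd_below_def)
  \<comment> \<open>The value at \<open>k = 0\<close> depends on the arbitrary initial data, so it enters the bound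
    separately.\<close>
  have "min m (lagrangian_value 0) \<le> lagrangian_value k" for k
  proof (cases k)
    case (Suc j)
    then show ?thesis
      using m[OF y_sign, of k] lagrangian_value_ge[of k] assms(2)[of k] by simp
  qed simp
  then show ?thesis
    by (rule bdd_belowI2)
qed

lemma convergent_lagrangian_values:
  assumes "bdd_below (range lagrangian_value)"
  shows "convergent lagrangian_value"
proof -
  have "decseq (\<lambda>k. lagrangian_value (Suc k))"
  proof (rule decseq_SucI)
    fix k
    have "0 \<le> descent_const L1 LH \<alpha> (\<rho> (Suc k)) * (norm (x (Suc (Suc k)) - x (Suc k)))\<^sup>2"
      using descent_const_pos[of "Suc k"] by simp
    then show "lagrangian_value (Suc (Suc k)) \<le> lagrangian_value (Suc k)"
      using descent[of "Suc k"] by simp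
  qed
  moreover obtain m where "\<And>k. m \<le> lagrangian_value k"
    using assms by (auto simp: bdd_below_def)
  ultimately obtain l where "(\<lambda>k. lagrangian_value (Suc k)) \<longlonglongrightarrow> l"
    using decseq_convergent[of "\<lambda>k. lagrangian_value (Suc k)" m] by blast
  then show ?thesis
    by (auto simp: convergent_def dest: LIMSEQ_imp_Suc)
qed

text \<open>The descent coefficient increases with the penalty, so if the penalty does not decrease,
  \<open>c = descent_const L1 LH \<alpha> (\<rho> 0)\<close> works at every iteration. The squared steps are then at most
  the decrements of a convergent sequence, divided by \<open>c\<close>.\<close>

lemma x_steps_vanish_growing:
  assumes "convergent lagrangian_value" "1 \<le> \<alpha>"
  shows "(\<lambda>k. x (Suc k) - x k) \<longlonglongrightarrow> 0"
proof -
  define c where "c = descent_const L1 LH \<alpha> (\<rho> 0)"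
  have c: "0 < c"
    unfolding c_def by (rule descent_const_pos)
  have c_le: "c \<le> descent_const L1 LH \<alpha> (\<rho> k)" for k
  proof -
    have "\<rho> 0 \<le> \<rho> k"
      using assms(2) penalty_pos[of 0] by (simp add: penalty_power[of k])
    then show ?thesis
      unfolding c_def descent_const_def using penalty_pos[of 0] growth_pos
      by (intro diff_mono divide_right_mono divide_left_mono mult_left_mono) auto
  qed
  obtain l where "lagrangian_value \<longlonglongrightarrow> l"
    using assms(1) by (auto simp: convergent_def)
  then have "(\<lambda>k. (lagrangian_value k - lagrangian_value (Suc k)) / c) \<longlonglongrightarrow> (l - l) / c"
    using c by (intro tendsto_intros LIMSEQ_Suc) auto
  moreover have "(norm (x (Suc k) - x k))\<^sup>2 \<le> (lagrangian_value k - lagrangian_value (Suc k)) / c"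
    if "1 \<le> k" for k
    using descent[OF that] mult_right_mono[OF c_le[of k], of "(norm (x (Suc k) - x k))\<^sup>2"] c
    by (simp add: pos_le_divide_eq mult.commute)
  ultimately have "(\<lambda>k. (norm (x (Suc k) - x k))\<^sup>2) \<longlonglongrightarrow> 0"
    by - (rule Lim_null_comparison
        [where g = "\<lambda>k. (lagrangian_value k - lagrangian_value (Suc k)) / c"],
        auto simp: eventually_sequentially)
  from tendsto_real_sqrt[OF this] show ?thesis
    by (simp add: tendsto_norm_zero_iff)
qed

text \<open>Pass to the limit in the penalty condition: \<open>\<rho>\<close> tends to zero, leaving
  \<open>- (\<alpha> + 1) L1\<^sup>2 \<ge> 0\<close>.\<close>

lemma smooth_const_zero_shrinking:
  assumes "\<alpha> < 1"
  shows "L1 = 0"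
proof -
  have "(\<lambda>k. \<alpha> ^ k * \<rho> 0) \<longlonglongrightarrow> 0 * \<rho> 0"
    using assms growth_pos by (intro tendsto_mult LIMSEQ_power_zero tendsto_const) auto
  then have "\<rho> \<longlonglongrightarrow> 0"
    unfolding penalty_power[symmetric] by simp
  then have "(\<lambda>k. (\<rho> k)\<^sup>2 - LH * \<rho> k - (\<alpha> + 1) * L1\<^sup>2) \<longlonglongrightarrow> 0\<^sup>2 - LH * 0 - (\<alpha> + 1) * L1\<^sup>2"
    by (intro tendsto_intros)
  then have "0 \<le> 0\<^sup>2 - LH * 0 - (\<alpha> + 1) * L1\<^sup>2"
    by (rule LIMSEQ_le_const) (use penalty_large in \<open>blast intro: less_imp_le\<close>)
  then show ?thesis
    using growth_pos by (simp add: mult_le_0_iff)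
qed

lemma residual_le:
  assumes "1 \<le> k"
  shows "norm (x (Suc k) - y (Suc k)) \<le> L1 / \<rho> k * norm (x (Suc k) - x k)"
  using multiplier_step_le[OF assms] penalty_pos[of k]
  by (simp add: residual_eq divide_right_mono)

text \<open>Here \<open>C = 0\<close>, and the residual vanishes from the second iteration on. Then the augmented
  Lagrangian is zero there, and descent with a positive coefficient leaves no room for a step.\<close>

lemma x_steps_vanish_shrinking:
  assumes "\<alpha> < 1"
  shows "(\<lambda>k. x (Suc k) - x k) \<longlonglongrightarrow> 0"
proof -
  have L1: "L1 = 0"
    by (rule smooth_const_zero_shrinking[OF assms])
  have C_zero: "C *v v = 0" for v
    using quad_smooth_norm_le[OF smooth, of v] L1 by simp
  have value_zero: "lagrangian_value k = 0" if "2 \<le> k" for k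
  proof -
    obtain j where j: "k = Suc j" "1 \<le> j"
      using \<open>2 \<le> k\<close> by (cases k) auto
    then have "x k = y k"
      using residual_le[of j] L1 by simp
    then show ?thesis
      by (simp add: aug_lagrangian_def quad_form_def C_zero)
  qed
  have "x (Suc k) - x k = 0" if "2 \<le> k" for k
  proof -
    have "descent_const L1 LH \<alpha> (\<rho> k) * (norm (x (Suc k) - x k))\<^sup>2 \<le> 0"
      using descent[of k] value_zero[of k] value_zero[of "Suc k"] that by simp
    then show ?thesis
      using descent_const_pos[of k] by (simp add: mult_le_0_iff)
  qed
  then show ?thesis
    by (intro tendsto_eventually) (auto simp: eventually_sequentially)
qed

lemma x_steps_vanish:
  assumes "convergent lagrangian_value"
  shows "(\<lambda>k. x (Suc k) - x k) \<longlonglongrightarrow> 0"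
  using x_steps_vanish_growing[OF assms] x_steps_vanish_shrinking by (cases "1 \<le> \<alpha>") auto

lemma residual_vanishes:
  assumes "(\<lambda>k. x (Suc k) - x k) \<longlonglongrightarrow> 0"
  shows "(\<lambda>k. x k - y k) \<longlonglongrightarrow> 0"
proof -
  have "norm (x (Suc k) - y (Suc k)) \<le> norm (x (Suc k) - x k)" if "1 \<le> k" for k
  proof -
    \<comment> \<open>This follows from the penalty condition, as \<open>(\<alpha> + 1) L1\<^sup>2 \<ge> L1\<^sup>2\<close>.\<close>
    have "L1 \<le> \<rho> k"
    proof (rule power2_le_imp_le)
      have "0 \<le> LH * \<rho> k" "0 \<le> \<alpha> * L1\<^sup>2"
        using LH_nonneg penalty_pos[of k] growth_pos by auto
      then show "L1\<^sup>2 \<le> (\<rho> k)\<^sup>2"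
        using penalty_large[of k] by (simp add: algebra_simps)
      show "0 \<le> \<rho> k"
        using penalty_pos[of k] by simp
    qed
    then have "L1 / \<rho> k * norm (x (Suc k) - x k) \<le> 1 * norm (x (Suc k) - x k)"
      using penalty_pos[of k] by (intro mult_right_mono) auto
    with residual_le[OF that] show ?thesis by simp
  qed
  then have "(\<lambda>k. x (Suc k) - y (Suc k)) \<longlonglongrightarrow> 0"
    by - (rule Lim_null_comparison[OF _ tendsto_norm_zero[OF assms]],
        auto simp: eventually_sequentially)
  then show ?thesis
    by (rule LIMSEQ_imp_Suc)
qed

text \<open>A step of \<open>y\<close> is a step of \<open>x\<close> corrected by two residuals, so it tends to zero; in the
  discrete set of sign vectors this stops \<open>y\<close> after finitely many iterations.\<close>

lemma iterates_converge_to_kkt: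
  assumes "convergent lagrangian_value"
  obtains v \<mu>s where "y \<longlonglongrightarrow> v" "x \<longlonglongrightarrow> v" "\<mu> \<longlonglongrightarrow> \<mu>s" "kkt_solution C v v \<mu>s"
proof -
  note step = x_steps_vanish[OF assms]
  note residual = residual_vanishes[OF step]
  have "(\<lambda>k. (x (Suc k) - x k) - (x (Suc k) - y (Suc k)) + (x k - y k)) \<longlonglongrightarrow> 0 - 0 + 0"
    by (intro tendsto_intros step residual LIMSEQ_Suc[OF residual])
  then have "(\<lambda>k. y (Suc k) - y k) \<longlonglongrightarrow> 0"
    by (simp add: algebra_simps)
  then obtain v where v: "v \<in> sign_vectors" "eventually (\<lambda>k. y k = v) sequentially"
    using sign_vectors_eventually_constant[of 1 y] y_sign by blast
  have y_lim: "y \<longlonglongrightarrow> v"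
    by (rule tendsto_eventually[OF v(2)])
  have x_lim: "x \<longlonglongrightarrow> v"
    using tendsto_add[OF residual y_lim] by simp
  have "(\<lambda>k. - (2 *\<^sub>R (C *v x k))) \<longlonglongrightarrow> - (2 *\<^sub>R (C *v v))"
    by (intro tendsto_intros x_lim bounded_linear.tendsto[OF matrix_vector_mul_bounded_linear])
  then have "\<mu> \<longlonglongrightarrow> - (2 *\<^sub>R (C *v v))"
    by (rule Lim_transform_eventually)
      (auto simp: eventually_sequentially multiplier_eq_neg_gradient intro!: exI[of _ 1])
  with y_lim x_lim show thesis
    by (rule that[OF _ _ _ kkt_solution_at_sign_vector[OF symmetric v(1) refl]])
qed

end

theorem theorem2p4:
  fixes C :: "real ^ 'n ^ 'n"
    and \<alpha> L1 LH :: real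
    and \<rho> :: "nat \<Rightarrow> real"
    and y x \<mu> :: "nat \<Rightarrow> real ^ 'n"
  assumes "transpose C = C"
    and "quad_smooth_const C L1"
    and "hessian_lower_const C LH"
    and "0 < \<alpha>"
    and "\<And>k. (\<rho> k)\<^sup>2 - LH * \<rho> k - (\<alpha> + 1) * L1\<^sup>2 > 0"
    and "\<And>k. \<rho> k > LH"
    and "vector_admm C \<alpha> \<rho> y x \<mu>"
  shows "(\<forall>k. descent_const L1 LH \<alpha> (\<rho> k) > 0) \<and>
    (\<forall>k\<ge>1. aug_lagrangian C (\<rho> (Suc k)) (y (Suc k)) (x (Suc k)) (\<mu> (Suc k))
              - aug_lagrangian C (\<rho> k) (y k) (x k) (\<mu> k)
            \<le> - descent_const L1 LH \<alpha> (\<rho> k) * (norm (x (Suc k) - x k))\<^sup>2) \<and>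
    (bdd_below (quad_form C ` sign_vectors) \<and> (\<forall>k. \<rho> k > L1) \<longrightarrow>
      bdd_below (range (\<lambda>k. aug_lagrangian C (\<rho> k) (y k) (x k) (\<mu> k))) \<and>
      convergent (\<lambda>k. aug_lagrangian C (\<rho> k) (y k) (x k) (\<mu> k)) \<and>
      (\<exists>ys xs \<mu>s. y \<longlonglongrightarrow> ys \<and> x \<longlonglongrightarrow> xs \<and> \<mu> \<longlonglongrightarrow> \<mu>s \<and>
         kkt_solution C ys xs \<mu>s \<and> xs = ys))"
proof -
  interpret vector_admm_run C \<alpha> L1 LH \<rho> y x \<mu>
    by unfold_locales (fact assms)+
  have run: "bdd_below (range lagrangian_value) \<and> convergent lagrangian_value \<and>
      (\<exists>ys xs \<mu>s. y \<longlonglongrightarrow> ys \<and> x \<longlonglongrightarrow> xs \<and> \<mu> \<longlonglongrightarrow> \<mu>s \<and> kkt_solution C ys xs \<mu>s \<and> xs = ys)"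
    if "bdd_below (quad_form C ` sign_vectors)" "\<forall>k. \<rho> k > L1"
  proof (intro conjI)
    show bounded: "bdd_below (range lagrangian_value)"
      by (rule bounded_below_lagrangian_values[OF that(1)]) (simp add: that(2) less_imp_le)
    show conv: "convergent lagrangian_value"
      by (rule convergent_lagrangian_values[OF bounded])
    obtain v \<mu>s where "y \<longlonglongrightarrow> v" "x \<longlonglongrightarrow> v" "\<mu> \<longlonglongrightarrow> \<mu>s" "kkt_solution C v v \<mu>s"
      by (rule iterates_converge_to_kkt[OF conv])
    from this refl show "\<exists>ys xs \<mu>s. y \<longlonglongrightarrow> ys \<and> x \<longlonglongrightarrow> xs \<and> \<mu> \<longlonglongrightarrow> \<mu>s \<and>
        kkt_solution C ys xs \<mu>s \<and> xs = ys"
      by (intro exI conjI)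
  qed
  show ?thesis
  proof (rule conjI[OF _ conjI])
    show "\<forall>k. descent_const L1 LH \<alpha> (\<rho> k) > 0"
      by (rule allI, rule descent_const_pos)
    show "\<forall>k\<ge>1. lagrangian_value (Suc k) - lagrangian_value k
        \<le> - descent_const L1 LH \<alpha> (\<rho> k) * (norm (x (Suc k) - x k))\<^sup>2"
      by (rule allI, rule impI, rule descent)
  qed (rule impI, elim conjE, rule run)
qed

end
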